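(* If $G$ is a GP$5$-graph, then $\gamma_{pr}(G)=\frac{2}{3}|V(G)|$.
   Context: All graphs are finite and simple. A graph $G=(V,E)$ is a GP$5$-graph if it is obtained from a connected graph $H=(V_H,E_H)$ with $V_H=\{v_1,\dots,v_n\}$ by adding, for each $v_i$, a vertex-disjoint path $a_ib_ic_id_ie_i$ on five new vertices and joining $v_i$ to the central vertex $c_i$: formally $V=V_H\cup\{a_i,b_i,c_i,d_i,e_i : i\in[n]\}$ and $E=E_H\cup\{v_ic_i,\,c_ib_i,\,c_id_i,\,b_ia_i,\,d_ie_i : i\in[n]\}$. For a graph with no isolated vertices, a paired dominating set is a set $D$ of vertices such that every vertex outside $D$ has a neighbor in $D$ and the subgraph induced by $D$ has a perfect matching; $\gamma_{pr}(G)$ denotes the minimum cardinality of a paired dominating set of $G$. *)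

theory Defs
  imports Complex_Main "Graph_Theory.Digraph_Component"
begin

text \<open>
  A finite simple graph is an instance of the locale \<^locale>\<open>graph\<close>: a finite symmetric digraph
  without loops or parallel arcs, in which an undirected edge is a pair of opposite arcs.
  Note that \<^const>\<open>connected\<close> excludes the graph without vertices.
\<close>

definition edges :: "('a, 'b) pre_digraph \<Rightarrow> 'a set set" where
  "edges G = {{u, v} | u v. u \<rightarrow>\<^bsub>G\<^esub> v}"

definition matching :: "('a, 'b) pre_digraph \<Rightarrow> 'a set set \<Rightarrow> bool" where
  "matching G M \<longleftrightarrow> M \<subseteq> edges G \<and> pairwise disjnt M"

definition perfect_matching :: "('a, 'b) pre_digraph \<Rightarrow> 'a set set \<Rightarrow> bool" where
  "perfect_matching G M \<longleftrightarrow> matching G M \<and> \<Union> M = verts G"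

definition dominating_set :: "('a, 'b) pre_digraph \<Rightarrow> 'a set \<Rightarrow> bool" where
  "dominating_set G D \<longleftrightarrow> D \<subseteq> verts G \<and> (\<forall>v \<in> verts G - D. \<exists>u \<in> D. v \<rightarrow>\<^bsub>G\<^esub> u)"

definition paired_dominating_set :: "('a, 'b) pre_digraph \<Rightarrow> 'a set \<Rightarrow> bool" where
  "paired_dominating_set G D \<longleftrightarrow> dominating_set G D \<and> (\<exists>M. perfect_matching (G \<restriction> D) M)"

text \<open>
  The minimum below is meaningful only if \<open>G\<close> is finite and has some paired dominating set,
  which holds for finite graphs without isolated vertices; otherwise its value is unspecified.
\<close>

definition paired_domination_number :: "('a, 'b) pre_digraph \<Rightarrow> nat" where
  "paired_domination_number G = Min {card D | D. paired_dominating_set G D}"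

text \<open>
  The path attached to \<open>v\<close> is \<open>a v, b v, c v, d v, e v\<close>: the paths are indexed by the vertices
  of \<open>H\<close> themselves instead of by a numbering of them.
\<close>

definition attaches_center_P5 ::
  "('a, 'b) pre_digraph \<Rightarrow> ('a \<Rightarrow> 'a) \<Rightarrow> ('a \<Rightarrow> 'a) \<Rightarrow> ('a \<Rightarrow> 'a) \<Rightarrow> ('a \<Rightarrow> 'a) \<Rightarrow> ('a \<Rightarrow> 'a) \<Rightarrow>
    ('a, 'b) pre_digraph \<Rightarrow> bool" where
  "attaches_center_P5 H a b c d e G \<longleftrightarrow>
    (let P = (\<lambda>v. {a v, b v, c v, d v, e v});
         E = (\<Union>v \<in> verts H. {(v, c v), (c v, b v), (c v, d v), (b v, a v), (d v, e v)})
     in (\<forall>v \<in> verts H. distinct [a v, b v, c v, d v, e v] \<and> P v \<inter> verts H = {}) \<and>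
        (\<forall>u \<in> verts H. \<forall>v \<in> verts H. u \<noteq> v \<longrightarrow> P u \<inter> P v = {}) \<and>
        verts G = verts H \<union> (\<Union>v \<in> verts H. P v) \<and>
        arcs_ends G = arcs_ends H \<union> E \<union> E\<inverse>)"

definition GP5_graph :: "('a, 'b) pre_digraph \<Rightarrow> bool" where
  "GP5_graph G \<longleftrightarrow> graph G \<and>
    (\<exists>(H :: ('a, 'b) pre_digraph) a b c d e.
      graph H \<and> connected H \<and> attaches_center_P5 H a b c d e G)"

end

theory Submission
  imports Defs
begin

text \<open>
  A paired dominating set contains every \<open>b v\<close> and \<open>d v\<close>: the leaf \<open>a v\<close> (or \<open>e v\<close>) is dominated by
  its only neighbour or else matched to it. The partners of \<open>b v\<close> and \<open>d v\<close> also lie on the path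
  at \<open>v\<close> and cannot both be \<open>c v\<close>, so each path contains at least four of its vertices. Choosing
  exactly \<open>b v, c v, d v, e v\<close> on each path attains this bound, as \<open>c v\<close> dominates \<open>v\<close>.
\<close>

lemma adj_induce_subgraph_iff: "u \<rightarrow>\<^bsub>G \<restriction> D\<^esub> v \<longleftrightarrow> u \<rightarrow>\<^bsub>G\<^esub> v \<and> u \<in> D \<and> v \<in> D"
  by (auto simp: arcs_ends_def arc_to_ends_def)

lemma perfect_matching_partner:
  assumes "perfect_matching G M" "symmetric G" "x \<in> verts G"
  obtains y where "{x, y} \<in> M" "x \<rightarrow>\<^bsub>G\<^esub> y"
proof -
  obtain p where p: "p \<in> M" "x \<in> p"
    using assms unfolding perfect_matching_def by blast
  then obtain u v where uv: "p = {u, v}" "u \<rightarrow>\<^bsub>G\<^esub> v"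
    using assms unfolding perfect_matching_def matching_def edges_def by blast
  then have "v \<rightarrow>\<^bsub>G\<^esub> u"
    using assms(2) by (auto simp: symmetric_def elim: symE)
  with p uv that show thesis
    by (auto simp: insert_commute)
qed

section \<open>Adjacency along the attached paths\<close>

locale attached_center_P5 = G: graph G + H: graph H
  for G :: "('a, 'b) pre_digraph" and H :: "('a, 'b) pre_digraph" +
  fixes a b c d e :: "'a \<Rightarrow> 'a"
  assumes attaches: "attaches_center_P5 H a b c d e G"
begin

definition P :: "'a \<Rightarrow> 'a set" where
  "P v = {a v, b v, c v, d v, e v}"

lemmas attaches_conds = attaches[unfolded attaches_center_P5_def Let_def, folded P_def]

lemma distinct_P: "v \<in> verts H \<Longrightarrow> distinct [a v, b v, c v, d v, e v]"
  by (drule bspec[OF attaches_conds[THEN conjunct1]]) (erule conjunct1)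

lemma P_disjoint_H: "v \<in> verts H \<Longrightarrow> P v \<inter> verts H = {}"
  by (drule bspec[OF attaches_conds[THEN conjunct1]]) (erule conjunct2)

lemma P_disjoint: "u \<in> verts H \<Longrightarrow> v \<in> verts H \<Longrightarrow> u \<noteq> v \<Longrightarrow> P u \<inter> P v = {}"
  using attaches_conds[THEN conjunct2, THEN conjunct1] by blast

lemma verts_G: "verts G = verts H \<union> (\<Union>v \<in> verts H. P v)"
  by (rule attaches_conds[THEN conjunct2, THEN conjunct2, THEN conjunct1])

lemma arcs_ends_G:
  "arcs_ends G = arcs_ends H
    \<union> (\<Union>v \<in> verts H. {(v, c v), (c v, b v), (c v, d v), (b v, a v), (d v, e v)})
    \<union> (\<Union>v \<in> verts H. {(v, c v), (c v, b v), (c v, d v), (b v, a v), (d v, e v)})\<inverse>"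
  by (rule attaches_conds[THEN conjunct2, THEN conjunct2, THEN conjunct2])

text \<open>Since \<open>x\<close> lies outside \<open>H\<close>, the arc cannot come from
  \<open>H\<close>, so it was added for some vertex \<open>u\<close>. Disjointness of the paths then
  leaves only \<open>u = v\<close>.\<close>

lemma adj_P_cases:
  assumes "x \<rightarrow>\<^bsub>G\<^esub> y" "v \<in> verts H" "x \<in> P v"
  shows "(x, y) \<in> {(v, c v), (c v, b v), (c v, d v), (b v, a v), (d v, e v)}
    \<union> {(v, c v), (c v, b v), (c v, d v), (b v, a v), (d v, e v)}\<inverse>"
proof -
  have "x \<notin> verts H"
    using assms P_disjoint_H by blast
  then have "\<not> x \<rightarrow>\<^bsub>H\<^esub> y"
    using H.adj_in_verts by blast
  then obtain u where u: "u \<in> verts H"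
    "(x, y) \<in> {(u, c u), (c u, b u), (c u, d u), (b u, a u), (d u, e u)}
      \<union> {(u, c u), (c u, b u), (c u, d u), (b u, a u), (d u, e u)}\<inverse>"
    using assms(1) unfolding arcs_ends_G by blast
  \<comment> \<open>Every end of an arc added for \<open>u\<close> lies in \<open>P u\<close>,
    except \<open>u\<close> itself, which is excluded because it belongs to
    \<open>H\<close>.\<close>
  then have "x \<in> P u"
    using \<open>x \<notin> verts H\<close> by (auto simp: P_def)
  then have "u = v"
    using P_disjoint[OF u(1) assms(2)] assms(3) by blast
  then show ?thesis
    using u(2) by (simp only:)
qed

text \<open>These neighbourhoods are what the lower bound uses: those of the leaves force
  \<open>b v\<close> and \<open>d v\<close> into the dominating set, and those of \<open>b v\<close>
  and \<open>d v\<close> keep their partners on the path.\<close>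

lemma adj_P:
  assumes "v \<in> verts H"
  shows "a v \<rightarrow>\<^bsub>G\<^esub> y \<Longrightarrow> y = b v"
    and "b v \<rightarrow>\<^bsub>G\<^esub> y \<Longrightarrow> y = a v \<or> y = c v"
    and "d v \<rightarrow>\<^bsub>G\<^esub> y \<Longrightarrow> y = e v \<or> y = c v"
    and "e v \<rightarrow>\<^bsub>G\<^esub> y \<Longrightarrow> y = d v"
proof -
  \<comment> \<open>The arc joining \<open>v\<close> to \<open>c v\<close> is among the possible
    cases, so \<open>v\<close> too must be told apart from the path vertices.\<close>
  have "v \<notin> P v"
    using P_disjoint_H[OF assms] assms by blast
  then have "distinct [v, a v, b v, d v, e v]" "distinct [a v, b v, c v, d v, e v]"
    using distinct_P[OF assms] by (simp_all add: P_def)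
  \<comment> \<open>The reversed lists provide each disequality in the opposite orientation as
    well.\<close>
  then have neq: "distinct [v, a v, b v, d v, e v]" "distinct [e v, d v, b v, a v, v]"
    "distinct [a v, b v, c v, d v, e v]" "distinct [e v, d v, c v, b v, a v]"
    using distinct_rev[of "[v, a v, b v, d v, e v]"] distinct_rev[of "[a v, b v, c v, d v, e v]"]
    by (simp_all only: rev.simps append.simps)
  note cases = adj_P_cases[OF _ assms, unfolded P_def]
  show "y = b v" if "a v \<rightarrow>\<^bsub>G\<^esub> y"
    using cases[OF that] neq by simp
  show "y = a v \<or> y = c v" if "b v \<rightarrow>\<^bsub>G\<^esub> y"
    using cases[OF that] neq by (simp; blast)
  show "y = e v \<or> y = c v" if "d v \<rightarrow>\<^bsub>G\<^esub> y"
    using cases[OF that] neq by (simp; blast)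
  show "y = d v" if "e v \<rightarrow>\<^bsub>G\<^esub> y"
    using cases[OF that] neq by simp
qed

lemma card_verts_G: "card (verts G) = 6 * card (verts H)"
proof -
  have "card (P v) = 5" if "v \<in> verts H" for v
    using distinct_P[OF that] by (simp add: P_def)
  then have "card (\<Union>v \<in> verts H. P v) = 5 * card (verts H)"
    using P_disjoint by (subst card_UN_disjoint) (auto simp: P_def)
  moreover have "verts H \<inter> (\<Union>v \<in> verts H. P v) = {}"
    using P_disjoint_H by blast
  ultimately show ?thesis
    unfolding verts_G by (subst card_Un_disjoint) (auto simp: P_def)
qed

section \<open>Lower bound\<close>

lemma card_paired_dominating_set_Int_P:
  assumes D: "paired_dominating_set G D" and v: "v \<in> verts H"
  shows "4 \<le> card (D \<inter> P v)"
proof -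
  obtain M where M: "perfect_matching (G \<restriction> D) M" and dom: "dominating_set G D"
    using D unfolding paired_dominating_set_def by blast
  have sym: "symmetric (G \<restriction> D)"
    using G.sym_arcs unfolding symmetric_def sym_def adj_induce_subgraph_iff by blast
  \<comment> \<open>In this unfolded form, every \<open>x\<close> in \<open>D\<close> has a matched
    partner that is a neighbour of \<open>x\<close> in \<open>G\<close> and lies in
    \<open>D\<close>.\<close>
  note partner = perfect_matching_partner[OF M sym, unfolded induce_subgraph_verts adj_induce_subgraph_iff]
  have leaf: "y \<in> D" if x: "x \<in> verts G" and unique: "\<And>z. x \<rightarrow>\<^bsub>G\<^esub> z \<Longrightarrow> z = y" for x y
  proof (cases "x \<in> D")
    case True
    then show ?thesis using partner unique by blast
  next
    case False
    then show ?thesis using dom x unique unfolding dominating_set_def by blast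
  qed
  have "a v \<in> verts G" "e v \<in> verts G"
    using v by (auto simp: verts_G P_def)
  then have bd: "b v \<in> D" "d v \<in> D"
    using leaf adj_P(1)[OF v] adj_P(4)[OF v] by metis+
  obtain x where x: "{b v, x} \<in> M" "b v \<rightarrow>\<^bsub>G\<^esub> x" "x \<in> D"
    using partner[OF bd(1)] by metis
  obtain y where y: "{d v, y} \<in> M" "d v \<rightarrow>\<^bsub>G\<^esub> y" "y \<in> D"
    using partner[OF bd(2)] by metis
  have xy: "x = a v \<or> x = c v" "y = e v \<or> y = c v"
    using adj_P(2)[OF v x(2)] adj_P(3)[OF v y(2)] .
  have "pairwise disjnt M"
    using M by (simp add: perfect_matching_def matching_def)
  \<comment> \<open>If both partners were \<open>c v\<close>, the two matching edges would meet,
    hence coincide, forcing \<open>b v = d v\<close>.\<close>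
  then have "{b v, x} = {d v, y} \<or> disjnt {b v, x} {d v, y}"
    using pairwiseD[OF _ x(1) y(1)] by metis
  then have "x \<noteq> y"
    using distinct_P[OF v] xy by (auto simp: doubleton_eq_iff)
  then have "card {b v, d v, x, y} = 4"
    using distinct_P[OF v] xy by auto
  moreover have "{b v, d v, x, y} \<subseteq> D \<inter> P v"
    using bd x(3) y(3) xy by (auto simp: P_def)
  ultimately show ?thesis
    by (metis card_mono finite_Int finite.emptyI finite.insertI P_def)
qed

text \<open>The paths are disjoint, so the bounds for the single paths add up; elements of
  \<open>D\<close> in \<open>H\<close> can only increase \<open>card D\<close>.\<close>

lemma card_paired_dominating_set_ge:
  assumes D: "paired_dominating_set G D"
  shows "4 * card (verts H) \<le> card D"
proof -
  have "D \<subseteq> verts G"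
    using D by (simp add: paired_dominating_set_def dominating_set_def)
  then have "finite D"
    by (rule finite_subset) simp
  have "4 * card (verts H) \<le> (\<Sum>v \<in> verts H. card (D \<inter> P v))"
    using sum_mono[of "verts H" "\<lambda>_. 4" "\<lambda>v. card (D \<inter> P v)"]
      card_paired_dominating_set_Int_P[OF D] by (simp add: mult.commute)
  also have "\<dots> = card (\<Union>v \<in> verts H. D \<inter> P v)"
    using P_disjoint by (subst card_UN_disjoint) (auto simp: P_def \<open>finite D\<close>)
  also have "\<dots> \<le> card D"
    using \<open>finite D\<close> by (intro card_mono) auto
  finally show ?thesis .
qed

section \<open>A paired dominating set attaining the bound\<close>

lemma paired_dominating_set_bcde:
  "paired_dominating_set G (\<Union>v \<in> verts H. {b v, c v, d v, e v})" (is "paired_dominating_set G ?D")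
proof -
  \<comment> \<open>On each path, the edges \<open>b v\<close>-\<open>c v\<close> and
    \<open>d v\<close>-\<open>e v\<close> pair up the four chosen vertices.\<close>
  let ?M = "\<Union>v \<in> verts H. {{b v, c v}, {d v, e v}}"
  have "dominating_set G ?D"
    unfolding dominating_set_def
  proof (intro conjI ballI)
    show "?D \<subseteq> verts G"
      by (auto simp: verts_G P_def)
    fix x assume "x \<in> verts G - ?D"
    then have x: "x \<in> verts H \<or> (\<exists>v \<in> verts H. x \<in> P v)" "x \<notin> ?D"
      unfolding verts_G by simp_all
    \<comment> \<open>The vertices left to dominate are those of \<open>H\<close>, dominated by
      \<open>c x\<close>, and on each path only the leaf \<open>a v\<close>, dominated by
      \<open>b v\<close>.\<close>
    from x(1) show "\<exists>u \<in> ?D. x \<rightarrow>\<^bsub>G\<^esub> u"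
    proof (elim disjE bexE)
      assume "x \<in> verts H"
      then have "x \<rightarrow>\<^bsub>G\<^esub> c x" "c x \<in> ?D"
        unfolding arcs_ends_G by blast+
      then show ?thesis by (rule bexI)
    next
      fix v assume v: "v \<in> verts H" "x \<in> P v"
      then have "x \<notin> {b v, c v, d v, e v}"
        using x(2) by blast
      then have "x = a v"
        using v(2) by (simp add: P_def)
      then have "x \<rightarrow>\<^bsub>G\<^esub> b v" "b v \<in> ?D"
        using v(1) unfolding arcs_ends_G by blast+
      then show ?thesis by (rule bexI)
    qed
  qed
  moreover have "pairwise disjnt ?M"
  proof (rule pairwiseI)
    fix p q assume "p \<in> ?M" "q \<in> ?M" "p \<noteq> q"
    then obtain u v where uv: "u \<in> verts H" "v \<in> verts H"
      "p \<in> {{b u, c u}, {d u, e u}}" "q \<in> {{b v, c v}, {d v, e v}}"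
      by blast
    show "disjnt p q"
    \<comment> \<open>Two edges of one path are disjoint because its vertices are distinct; edges of
      different paths lie in disjoint sets \<open>P u\<close> and \<open>P v\<close>.\<close>
    proof (cases "u = v")
      case True
      then show ?thesis
        using uv \<open>p \<noteq> q\<close> distinct_P[of v] by (auto simp: disjnt_def)
    next
      case False
      moreover have "p \<subseteq> P u" "q \<subseteq> P v"
        using uv by (auto simp: P_def)
      ultimately show ?thesis
        using P_disjoint uv unfolding disjnt_def by blast
    qed
  qed
  moreover have "?M \<subseteq> edges (G \<restriction> ?D)"
  proof
    fix p assume "p \<in> ?M"
    then obtain v where v: "v \<in> verts H" "p = {b v, c v} \<or> p = {d v, e v}"
      by blast
    then have "b v \<rightarrow>\<^bsub>G \<restriction> ?D\<^esub> c v" "d v \<rightarrow>\<^bsub>G \<restriction> ?D\<^esub> e v"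
      unfolding adj_induce_subgraph_iff arcs_ends_G by blast+
    then show "p \<in> edges (G \<restriction> ?D)"
      using v(2) unfolding edges_def by blast
  qed
  moreover have "\<Union> ?M = verts (G \<restriction> ?D)"
    by auto
  ultimately show ?thesis
    unfolding paired_dominating_set_def perfect_matching_def matching_def
    by (intro conjI exI[of _ ?M])
qed

lemma card_bcde: "card (\<Union>v \<in> verts H. {b v, c v, d v, e v}) = 4 * card (verts H)"
proof -
  have "card {b v, c v, d v, e v} = 4" if "v \<in> verts H" for v
    using distinct_P[OF that] by simp
  moreover have "{b u, c u, d u, e u} \<inter> {b v, c v, d v, e v} = {}"
    if "u \<in> verts H" "v \<in> verts H" "u \<noteq> v" for u v
    using P_disjoint[OF that] unfolding P_def by blast
  ultimately show ?thesis
    by (subst card_UN_disjoint) auto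
qed

lemma paired_domination_number_G: "paired_domination_number G = 4 * card (verts H)"
  unfolding paired_domination_number_def
proof (rule Min_eqI)
  \<comment> \<open>\<open>Min\<close> is determined only for finite sets; here finiteness holds
    because all candidates are subsets of the finite vertex set.\<close>
  have "{card D | D. paired_dominating_set G D} \<subseteq> card ` Pow (verts G)"
    by (auto simp only: paired_dominating_set_def dominating_set_def Pow_iff)
  then show "finite {card D | D. paired_dominating_set G D}"
    by (rule finite_subset) simp
  show "4 * card (verts H) \<le> k" if "k \<in> {card D | D. paired_dominating_set G D}" for k
    using that card_paired_dominating_set_ge by blast
  show "4 * card (verts H) \<in> {card D | D. paired_dominating_set G D}"
    using paired_dominating_set_bcde card_bcde[symmetric] by blast
qed

end

theorem theorem3:
  fixes G :: "('a, 'b) pre_digraph"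
  assumes "GP5_graph G"
  shows "real (paired_domination_number G) = 2 / 3 * real (card (verts G))"
proof -
  obtain H :: "('a, 'b) pre_digraph" and a b c d e
    where "graph G" "graph H" "attaches_center_P5 H a b c d e G"
    using assms unfolding GP5_graph_def by blast
  then interpret attached_center_P5 G H a b c d e
    by (simp add: attached_center_P5_def attached_center_P5_axioms_def)
  show ?thesis
    \<comment> \<open>With n vertices in \<open>H\<close>, the two sides are 4n and two thirds of
      6n.\<close>
    by (simp add: paired_domination_number_G card_verts_G)
qed

end
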